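(* Let $\mathbb{I}$ be the icosahedron graph. Then $k(\mathbb{I})=4$.
   Context: All graphs are simple and undirected. The icosahedron graph $\mathbb{I}$ is the graph formed by the $12$ vertices and $30$ edges of a regular icosahedron (a $5$-regular planar graph all of whose faces are triangles). The competition graph $C(D)$ of a digraph $D$ is the graph with vertex set $V(D)$ in which two distinct vertices $x,y$ are adjacent if and only if there is a vertex $v$ with $(x,v)$ and $(y,v)$ both arcs of $D$. The competition number $k(G)$ of a graph $G$ is the minimum integer $k\ge 0$ such that $G$ together with $k$ new isolated vertices is the competition graph of some acyclic digraph. *)

theory Defs
  imports "HOL-Analysis.Product_Vector" "Graph_Theory.Pair_Digraph"
begin

text \<open>
  Digraphs are \<^typ>\<open>'a pair_pre_digraph\<close>. As usual in this library, a simple undirected graph is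
  a \<^const>\<open>pair_graph\<close>, with an edge represented by its two opposite arcs.
\<close>

definition competition_graph :: "'a pair_pre_digraph \<Rightarrow> 'a pair_pre_digraph" where
  "competition_graph D =
     \<lparr> pverts = pverts D,
       parcs = {(x, y). x \<in> pverts D \<and> y \<in> pverts D \<and> x \<noteq> y \<and>
                  (\<exists>v\<in>pverts D. (x, v) \<in> parcs D \<and> (y, v) \<in> parcs D)} \<rparr>"

definition add_isolated :: "nat \<Rightarrow> 'a pair_pre_digraph \<Rightarrow> ('a + nat) pair_pre_digraph" where
  "add_isolated k G =
     \<lparr> pverts = Inl ` pverts G \<union> Inr ` {..<k},
       parcs = map_prod Inl Inl ` parcs G \<rparr>"

definition is_acyclic_competition_graph :: "'a pair_pre_digraph \<Rightarrow> bool" where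
  "is_acyclic_competition_graph G \<longleftrightarrow>
     (\<exists>D. pair_wf_digraph D \<and> acyclic (parcs D) \<and> competition_graph D = G)"

definition competition_number :: "'a pair_pre_digraph \<Rightarrow> nat" where
  "competition_number G = (LEAST k. is_acyclic_competition_graph (add_isolated k G))"

text \<open>The minimum exists for every finite simple graph.\<close>

lemma competition_number_exists:
  assumes "pair_graph G"
  shows "\<exists>k. is_acyclic_competition_graph (add_isolated k G)"
proof -
  interpret pair_graph G by fact
  obtain f where f: "bij_betw f (parcs G) {..<card (parcs G)}"
    using ex_bij_betw_finite_nat[OF pair_finite_arcs] by (auto simp: atLeast0LessThan)
  define k where "k = card (parcs G)"
  define A :: "('a + nat) rel" where
    "A = {(Inl x, Inr (f e)) | x e. e \<in> parcs G \<and> (x = fst e \<or> x = snd e)}"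
  define D where "D = \<lparr> pverts = Inl ` pverts G \<union> Inr ` {..<k}, parcs = A \<rparr>"
  have fk: "f e < k" if "e \<in> parcs G" for e
    using bij_betwE[OF f] that by (auto simp: k_def)
  have inj: "f e = f e' \<longleftrightarrow> e = e'" if "e \<in> parcs G" "e' \<in> parcs G" for e e'
    using bij_betw_imp_inj_on[OF f] that by (auto simp: inj_on_eq_iff)
  have wf: "pair_wf_digraph D"
    by unfold_locales (auto simp: D_def A_def fk dest: wellformed')
  have "A \<subseteq> measure (\<lambda>z. case z of Inl _ \<Rightarrow> 0 | Inr _ \<Rightarrow> Suc 0)"
    by (auto simp: A_def)
  hence ac: "acyclic (parcs D)"
    unfolding D_def by (auto intro!: wf_acyclic wf_subset[OF wf_measure])
  have sym: "(y, x) \<in> parcs G" if "(x, y) \<in> parcs G" for x y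
    using that pair_sym_arcs by (auto simp: symmetric_def dest: symD)
  have adj: "(\<exists>v\<in>pverts D. (p, v) \<in> A \<and> (q, v) \<in> A) \<and> p \<noteq> q \<longleftrightarrow>
      (p, q) \<in> map_prod Inl Inl ` parcs G" (is "?L \<longleftrightarrow> ?R") for p q
  proof
    assume ?L
    then obtain v where "(p, v) \<in> A" "(q, v) \<in> A" "p \<noteq> q" by blast
    moreover from this obtain x e where "p = Inl x" "v = Inr (f e)" "e \<in> parcs G"
      "x = fst e \<or> x = snd e" unfolding A_def by blast
    moreover from calculation obtain y e' where "q = Inl y" "v = Inr (f e')" "e' \<in> parcs G"
      "y = fst e' \<or> y = snd e'" unfolding A_def by blast
    ultimately have *: "p = Inl x" "q = Inl y" "x \<noteq> y" "e \<in> parcs G" "e' \<in> parcs G"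
      "f e = f e'" "x = fst e \<or> x = snd e" "y = fst e' \<or> y = snd e'"
      by simp_all
    with inj have "e = e'" by blast
    with * sym[of "fst e" "snd e"] have "(x, y) \<in> parcs G" by (cases e) auto
    with * show ?R by (auto intro!: image_eqI[of _ _ "(x, y)"])
  next
    assume ?R
    then obtain x y where *: "p = Inl x" "q = Inl y" "(x, y) \<in> parcs G" by auto
    then have "(p, Inr (f (x, y))) \<in> A" "(q, Inr (f (x, y))) \<in> A" "Inr (f (x, y)) \<in> pverts D"
      by (force simp: A_def D_def fk)+
    moreover have "p \<noteq> q" using * pair_no_loops[OF *(3)] by auto
    ultimately show ?L by blast
  qed
  have sub: "p \<in> Inl ` pverts G \<and> q \<in> Inl ` pverts G" if "(p, q) \<in> map_prod Inl Inl ` parcs G"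
    for p q :: "'a + nat"
    using that by (auto dest: wellformed')
  have "{(p, q). p \<in> pverts D \<and> q \<in> pverts D \<and> p \<noteq> q \<and> (\<exists>v\<in>pverts D. (p, v) \<in> A \<and> (q, v) \<in> A)}
      = {(p, q). p \<in> pverts D \<and> q \<in> pverts D \<and> (p, q) \<in> map_prod Inl Inl ` parcs G}"
    using adj by blast
  also have "\<dots> = map_prod Inl Inl ` parcs G"
    using sub by (fastforce simp: D_def)
  finally have "competition_graph D = add_isolated k G"
    by (simp add: competition_graph_def add_isolated_def D_def)
  with wf ac show ?thesis
    unfolding is_acyclic_competition_graph_def by blast
qed

text \<open>
  The vertices of the icosahedron are the two poles 0 and 11, the upper pentagon 1, ..., 5 and the
  lower pentagon 6, ..., 10.
\<close>

definition icosahedron_edges :: "nat rel" where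
  "icosahedron_edges =
     (\<Union>i\<in>{1..5}. {(0, i), (i, i mod 5 + 1), (i, i + 5), (i, i mod 5 + 6),
                   (i + 5, i mod 5 + 6), (i + 5, 11)})"

definition icosahedron :: "nat pair_pre_digraph" where
  "icosahedron =
     \<lparr> pverts = {0..<12}, parcs = icosahedron_edges \<union> icosahedron_edges\<inverse> \<rparr>"

lemma icosahedron_edges_eq:
  "icosahedron_edges = {(0,1), (1,2), (1,6), (1,7), (6,7), (6,11),
     (0,2), (2,3), (2,7), (2,8), (7,8), (7,11),
     (0,3), (3,4), (3,8), (3,9), (8,9), (8,11),
     (0,4), (4,5), (4,9), (4,10), (9,10), (9,11),
     (0,5), (5,1), (5,10), (5,6), (10,6), (10,11)}"
proof -
  have *: "{1..5} = {5, 4, 3, 2, 1::nat}" by auto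
  show ?thesis unfolding icosahedron_edges_def * by (simp del: One_nat_def)
qed

lemma icosahedron_verts_eq: "pverts icosahedron = {0, 1, 2, 3, 4, 5, 6, 7, 8, 9, 10, 11}"
proof -
  have "pverts icosahedron = set [0..<12]" by (simp add: icosahedron_def)
  also have "\<dots> = {0, 1, 2, 3, 4, 5, 6, 7, 8, 9, 10, 11}"
    by (simp add: upt_rec eval_nat_numeral)
  finally show ?thesis .
qed

lemma pair_graph_icosahedron: "pair_graph icosahedron"
proof
  show "finite (parcs icosahedron)"
    by (simp add: icosahedron_def icosahedron_edges_eq)
  show "symmetric icosahedron"
    by (simp add: icosahedron_def symmetric_def sym_Un_converse)
qed (auto simp: icosahedron_def icosahedron_edges_eq)

lemma card_icosahedron_edges: "card icosahedron_edges = 30"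
  by (simp add: icosahedron_edges_eq)

lemma icosahedron_5_regular:
  assumes "u \<in> pverts icosahedron"
  shows "card {v. (u, v) \<in> parcs icosahedron} = 5"
proof -
  have u: "u \<in> {0, 1, 2, 3, 4, 5, 6, 7, 8, 9, 10, 11}"
    using assms unfolding icosahedron_verts_eq .
  have eq: "{v. (u, v) \<in> parcs icosahedron} =
      set (filter (\<lambda>v. (u, v) \<in> parcs icosahedron) [0, 1, 2, 3, 4, 5, 6, 7, 8, 9, 10, 11])"
    by (auto simp: icosahedron_def icosahedron_edges_eq)
  show ?thesis
    unfolding eq using u unfolding insert_iff empty_iff
    by (elim disjE) (simp_all add: icosahedron_def icosahedron_edges_eq)
qed

text \<open>
  This is the graph of the regular icosahedron in space: with the golden ratio \<open>\<phi>\<close>, its vertices are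
  the twelve points \<open>(0, \<plusminus>1, \<plusminus>\<phi>)\<close> up to cyclic permutation, and its edges join the points at
  the minimal distance 2.
\<close>

definition icosahedron_coord :: "nat \<Rightarrow> real \<times> real \<times> real" where
  "icosahedron_coord v = (let \<phi> = (1 + sqrt 5) / 2 in
     [(0, 1, \<phi>),
      (0, -1, \<phi>), (\<phi>, 0, 1), (1, \<phi>, 0), (-1, \<phi>, 0), (-\<phi>, 0, 1),
      (-1, -\<phi>, 0), (1, -\<phi>, 0), (\<phi>, 0, -1), (0, 1, -\<phi>), (-\<phi>, 0, -1),
      (0, -1, -\<phi>)] ! v)"

lemma icosahedron_coord_image:
  defines "\<phi> \<equiv> (1 + sqrt 5) / 2"
  shows "icosahedron_coord ` pverts icosahedron =
    (\<Union>s\<in>{-1, 1}. \<Union>t\<in>{-1, 1}. {(0, s, t * \<phi>), (s, t * \<phi>, 0), (t * \<phi>, 0, s)})"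
  by (simp add: icosahedron_verts_eq icosahedron_coord_def Let_def insert_commute
      flip: \<phi>_def)

lemma icosahedron_geometric:
  assumes "u \<in> pverts icosahedron" "v \<in> pverts icosahedron" "u \<noteq> v"
  shows "(u, v) \<in> parcs icosahedron \<longleftrightarrow> dist (icosahedron_coord u) (icosahedron_coord v) = 2"
    and "dist (icosahedron_coord u) (icosahedron_coord v) \<ge> 2"
proof -
  define \<phi> :: real where "\<phi> = (1 + sqrt 5) / 2"
  have \<phi>2: "\<phi> * \<phi> = \<phi> + 1" by (simp add: \<phi>_def field_simps)
  have \<phi>1: "\<phi> > 1" by (simp add: \<phi>_def)
  define d where "d = (\<lambda>(a, b, c) (a', b', c'). (a - a')\<^sup>2 + (b - b')\<^sup>2 + (c - c')\<^sup>2 :: real)"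
  have dist: "dist p q = sqrt (d p q)" for p q
    by (cases p; cases q) (simp add: d_def dist_prod_def dist_real_def add.assoc)
  have two: "2 = sqrt (4::real)" by simp
  have c: "icosahedron_coord 0 = (0, 1, \<phi>)" "icosahedron_coord 1 = (0, -1, \<phi>)"
    "icosahedron_coord 2 = (\<phi>, 0, 1)" "icosahedron_coord 3 = (1, \<phi>, 0)"
    "icosahedron_coord 4 = (-1, \<phi>, 0)" "icosahedron_coord 5 = (-\<phi>, 0, 1)"
    "icosahedron_coord 6 = (-1, -\<phi>, 0)" "icosahedron_coord 7 = (1, -\<phi>, 0)"
    "icosahedron_coord 8 = (\<phi>, 0, -1)" "icosahedron_coord 9 = (0, 1, -\<phi>)"
    "icosahedron_coord 10 = (-\<phi>, 0, -1)" "icosahedron_coord 11 = (0, -1, -\<phi>)"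
    by (simp_all add: icosahedron_coord_def Let_def \<phi>_def)
  have d: "d (a, b, c) (a', b', c') =
      a * a + b * b + c * c + a' * a' + b' * b' + c' * c' - 2 * (a * a' + b * b' + c * c')"
    for a b c a' b' c'
    by (simp add: d_def power2_eq_square algebra_simps)
  have "\<forall>u\<in>{0, 1, 2, 3, 4, 5, 6, 7, 8, 9, 10, 11}. \<forall>v\<in>{0, 1, 2, 3, 4, 5, 6, 7, 8, 9, 10, 11}. u \<noteq> v \<longrightarrow>
      (if (u, v) \<in> parcs icosahedron then d (icosahedron_coord u) (icosahedron_coord v) = 4
       else d (icosahedron_coord u) (icosahedron_coord v) > 4)"
    using \<phi>1 by (simp add: icosahedron_def icosahedron_edges_eq c d \<phi>2 del: One_nat_def)
  with assms have "if (u, v) \<in> parcs icosahedron then d (icosahedron_coord u) (icosahedron_coord v) = 4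
       else d (icosahedron_coord u) (icosahedron_coord v) > 4"
    unfolding icosahedron_verts_eq by blast
  then show "(u, v) \<in> parcs icosahedron \<longleftrightarrow> dist (icosahedron_coord u) (icosahedron_coord v) = 2"
    and "dist (icosahedron_coord u) (icosahedron_coord v) \<ge> 2"
    unfolding dist two real_sqrt_eq_iff real_sqrt_le_iff by (auto split: if_splits)
qed

end

theory Submission
  imports Defs
begin

text \<open>
  Upper bound: the arcs of an acyclic digraph realising a graph amount to an assignment of cliques,
  covering all edges, to the vertices, each clique preceding its vertex in some linear order; for the
  icosahedron with four extra vertices, thirteen of its triangles do this.

  Lower bound: in a realisation with \<open>k\<close> extra vertices, take the last three vertices \<open>W\<close> of the
  icosahedron in the acyclic order. Their out-neighbours are among the \<open>k\<close> extra vertices and the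
  last two of them, so the edges meeting \<open>W\<close> are covered by \<open>k + 2\<close> cliques. But such a cover needs
  six cliques. Each vertex has degree 5 and cliques have at most 3 vertices, so each vertex lies
  in at least three of the cliques; hence two non-adjacent vertices in \<open>W\<close> already use six. If \<open>W\<close> is a
  triangle belonging to the cover, the other cliques each contain at most two of the nine edges leaving
  \<open>W\<close>, so there are at least five. If \<open>W\<close> is a triangle not in the cover, then its three edges, and for
  each \<open>x \<in> W\<close> the edge from \<open>x\<close> to its neighbour that is adjacent to no other vertex of \<open>W\<close>, lie
  in six different cliques.
\<close>

section \<open>Competition graphs and clique covers\<close>

text \<open>\<open>C v\<close> is made the in-neighbourhood of \<open>v\<close>: two vertices then
  compete through \<open>v\<close> exactly when both lie in \<open>C v\<close>, and every arc raises
  \<open>rank\<close>.\<close>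

lemma acyclic_competition_graphI:
  fixes G :: "'a pair_pre_digraph" and C :: "'a + nat \<Rightarrow> 'a set" and rank :: "'a + nat \<Rightarrow> nat"
    and k :: nat
  defines "V \<equiv> Inl ` pverts G \<union> Inr ` {..<k}"
  assumes "pair_graph G"
    and sub: "\<And>v. v \<in> V \<Longrightarrow> C v \<subseteq> pverts G"
    and clique: "\<And>v x y. v \<in> V \<Longrightarrow> x \<in> C v \<Longrightarrow> y \<in> C v \<Longrightarrow> x \<noteq> y \<Longrightarrow> (x, y) \<in> parcs G"
    and cover: "\<And>x y. (x, y) \<in> parcs G \<Longrightarrow> \<exists>v\<in>V. x \<in> C v \<and> y \<in> C v"
    and rank: "\<And>v x. v \<in> V \<Longrightarrow> x \<in> C v \<Longrightarrow> rank (Inl x) < rank v"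
  shows "is_acyclic_competition_graph (add_isolated k G)"
proof -
  interpret pair_graph G by fact
  define A :: "('a + nat) rel" where "A = {(Inl x, v) | x v. v \<in> V \<and> x \<in> C v}"
  define D where "D = \<lparr> pverts = V, parcs = A \<rparr>"
  have "pair_wf_digraph D"
    using sub by unfold_locales (fastforce simp: D_def A_def V_def)+
  moreover have "A \<subseteq> measure rank"
    using rank by (auto simp: A_def)
  hence "acyclic (parcs D)"
    by (auto simp: D_def intro: wf_acyclic wf_subset[OF wf_measure])
  moreover have "competition_graph D = add_isolated k G"
  proof -
    have "(p \<in> V \<and> q \<in> V \<and> p \<noteq> q \<and> (\<exists>v\<in>V. (p, v) \<in> A \<and> (q, v) \<in> A)) \<longleftrightarrow>
        (p, q) \<in> map_prod Inl Inl ` parcs G" for p q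
    proof
      assume "p \<in> V \<and> q \<in> V \<and> p \<noteq> q \<and> (\<exists>v\<in>V. (p, v) \<in> A \<and> (q, v) \<in> A)"
      then obtain x y v where "v \<in> V" "p = Inl x" "q = Inl y" "x \<noteq> y" "x \<in> C v" "y \<in> C v"
        unfolding A_def by blast
      with clique show "(p, q) \<in> map_prod Inl Inl ` parcs G"
        by (auto intro!: image_eqI[of _ _ "(x, y)"])
    next
      assume "(p, q) \<in> map_prod Inl Inl ` parcs G"
      then obtain x y where xy: "(x, y) \<in> parcs G" "p = Inl x" "q = Inl y"
        by auto
      with cover[OF xy(1)] pair_no_loops[OF xy(1)] wellformed'[OF xy(1)]
      show "p \<in> V \<and> q \<in> V \<and> p \<noteq> q \<and> (\<exists>v\<in>V. (p, v) \<in> A \<and> (q, v) \<in> A)"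
        by (auto simp: A_def V_def)
    qed
    thus ?thesis
      by (auto simp: competition_graph_def add_isolated_def D_def V_def)
  qed
  ultimately show ?thesis
    unfolding is_acyclic_competition_graph_def by blast
qed

text \<open>\<open>W\<close> grows by sinks of the part of \<open>V\<close> not yet taken.
  \<open>u\<close> is the last one added, so no arc from \<open>W\<close> enters it; leaving
  \<open>u\<close> out gives \<open>m\<close> possible targets instead of
  \<open>Suc m\<close>.\<close>

lemma acyclic_final_segment:
  assumes "finite V" "acyclic r" "Suc m \<le> card V"
  shows "\<exists>W u. W \<subseteq> V \<and> card W = Suc m \<and> u \<in> W \<and> (\<forall>x\<in>W. \<forall>y\<in>V. (x, y) \<in> r \<longrightarrow> y \<in> W - {u})"
proof -
  \<comment> \<open>The converse makes minimal elements of \<open>V - W\<close> those without an arc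
    into \<open>V - W\<close>.\<close>
  have wf: "wf ((r \<inter> V \<times> V)\<inverse>)"
    using assms by (intro finite_acyclic_wf_converse) (auto intro: acyclic_subset)
  have extend: "\<exists>u. u \<in> V - W \<and> (\<forall>x\<in>insert u W. \<forall>y\<in>V. (x, y) \<in> r \<longrightarrow> y \<in> W)"
    if W: "W \<subseteq> V" "card W < card V" "\<forall>x\<in>W. \<forall>y\<in>V. (x, y) \<in> r \<longrightarrow> y \<in> W" for W
  proof -
    have "V - W \<noteq> {}"
      using W(1,2) by auto
    then obtain u where u: "u \<in> V - W" "\<And>y. (y, u) \<in> (r \<inter> V \<times> V)\<inverse> \<Longrightarrow> y \<notin> V - W"
      by (rule wfE_min'[OF wf]) blast
    have "y \<in> W" if "x \<in> insert u W" "y \<in> V" "(x, y) \<in> r" for x y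
      using that u W(3) by (cases "x = u") auto
    with u(1) show ?thesis by blast
  qed
  have step: "\<exists>W' u. W' \<subseteq> V \<and> card W' = Suc (card W) \<and> u \<in> W' \<and>
      (\<forall>x\<in>W'. \<forall>y\<in>V. (x, y) \<in> r \<longrightarrow> y \<in> W' - {u})"
    if W: "W \<subseteq> V" "card W < card V" "\<forall>x\<in>W. \<forall>y\<in>V. (x, y) \<in> r \<longrightarrow> y \<in> W" for W
  proof -
    obtain u where u: "u \<in> V - W" "\<forall>x\<in>insert u W. \<forall>y\<in>V. (x, y) \<in> r \<longrightarrow> y \<in> W"
      using extend[OF W] by blast
    have "finite W"
      using W(1) assms(1) by (rule finite_subset)
    hence "card (insert u W) = Suc (card W)"
      using u(1) by simp
    moreover have "insert u W - {u} = W"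
      using u(1) by simp
    ultimately show ?thesis
      using u W(1) by (intro exI[of _ "insert u W"] exI[of _ u]) simp
  qed
  show ?thesis
    using assms(3)
  proof (induction m)
    case 0
    thus ?case using step[of "{}"] by simp
  next
    case (Suc m)
    then obtain W u where "W \<subseteq> V" "card W = Suc m"
      "\<forall>x\<in>W. \<forall>y\<in>V. (x, y) \<in> r \<longrightarrow> y \<in> W - {u}"
      using Suc_leD by blast
    thus ?case using step[of W] Suc.prems by simp
  qed
qed

text \<open>In-neighbourhoods are cliques, and an edge at \<open>x\<close> lies in that of a common
  out-neighbour \<open>v\<close>. For \<open>x\<close> in the final segment, \<open>v\<close> is one
  of \<open>k\<close> extra vertices or one of the \<open>m\<close> members other than
  \<open>u\<close>.\<close>

lemma acyclic_competition_graph_clique_cover: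
  fixes G :: "'a pair_pre_digraph"
  assumes comp: "is_acyclic_competition_graph (add_isolated k G)"
    and fin: "finite (pverts G)" and m: "Suc m \<le> card (pverts G)"
  obtains W and I :: "('a + nat) set" and C where
    "W \<subseteq> pverts G" "card W = Suc m" "finite I" "card I = k + m"
    "\<And>i. i \<in> I \<Longrightarrow> C i \<subseteq> pverts G"
    "\<And>i x y. i \<in> I \<Longrightarrow> x \<in> C i \<Longrightarrow> y \<in> C i \<Longrightarrow> x \<noteq> y \<Longrightarrow> (x, y) \<in> parcs G"
    "\<And>x y. x \<in> W \<Longrightarrow> (x, y) \<in> parcs G \<Longrightarrow> \<exists>i\<in>I. x \<in> C i \<and> y \<in> C i"
proof -
  obtain D where D: "pair_wf_digraph D" "acyclic (parcs D)" "competition_graph D = add_isolated k G"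
    using comp unfolding is_acyclic_competition_graph_def by blast
  let ?V = "Inl ` pverts G :: ('a + nat) set"
  have verts: "pverts D = ?V \<union> Inr ` {..<k}"
    using arg_cong[OF D(3), of pverts] by (simp add: competition_graph_def add_isolated_def)
  have adj: "(x, y) \<in> parcs G \<longleftrightarrow> x \<noteq> y \<and> Inl x \<in> pverts D \<and> Inl y \<in> pverts D \<and>
      (\<exists>v\<in>pverts D. (Inl x, v) \<in> parcs D \<and> (Inl y, v) \<in> parcs D)" for x y
  proof -
    have "(x, y) \<in> parcs G \<longleftrightarrow> (Inl x, Inl y) \<in> parcs (competition_graph D)"
      unfolding D(3) by (auto simp: add_isolated_def)
    thus ?thesis by (auto simp: competition_graph_def)
  qed
  \<comment> \<open>The final segment is taken among the original vertices only; the extra ones may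
    stand anywhere in the order.\<close>
  have "\<exists>W u. W \<subseteq> ?V \<and> card W = Suc m \<and> u \<in> W \<and>
      (\<forall>x\<in>W. \<forall>y\<in>?V. (x, y) \<in> parcs D \<longrightarrow> y \<in> W - {u})"
    using fin m D(2) by (intro acyclic_final_segment) (auto simp: card_image)
  then obtain W' u where W': "W' \<subseteq> ?V" "card W' = Suc m" "u \<in> W'"
    and final: "\<forall>x\<in>W'. \<forall>y\<in>?V. (x, y) \<in> parcs D \<longrightarrow> y \<in> W' - {u}"
    by (elim exE conjE)
  have finW': "finite W'"
    using W'(2) card.infinite by fastforce
  define W where "W = Inl -` W'"
  have WW': "W' = Inl ` W"
    using W'(1) by (auto simp: W_def)
  define I where "I = (W' - {u}) \<union> Inr ` {..<k}"
  define C where "C v = {x \<in> pverts G. (Inl x, v) \<in> parcs D}" for v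
  have I_sub: "I \<subseteq> pverts D"
    using W'(1) by (auto simp: I_def verts)
  show ?thesis
  proof
    show "W \<subseteq> pverts G"
      using W'(1) by (auto simp: W_def)
    show "card W = Suc m"
      using W'(2) by (simp add: WW' card_image)
    show "finite I"
      using finW' by (simp add: I_def)
    have "card I = card (W' - {u}) + card (Inr ` {..<k} :: ('a + nat) set)"
      unfolding I_def using finW' W'(1) by (intro card_Un_disjoint) auto
    thus "card I = k + m"
      using W' finW' by (simp add: card_image)
    show "C i \<subseteq> pverts G" for i
      by (auto simp: C_def)
  next
    fix i x y assume "i \<in> I" "x \<in> C i" "y \<in> C i" "x \<noteq> y"
    moreover from this have "i \<in> pverts D"
      using I_sub by blast
    ultimately show "(x, y) \<in> parcs G"
      by (auto simp: adj C_def verts)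
  next
    fix x y assume xy: "x \<in> W" "(x, y) \<in> parcs G"
    then obtain v where v: "v \<in> pverts D" "(Inl x, v) \<in> parcs D" "(Inl y, v) \<in> parcs D"
      and mem: "Inl x \<in> pverts D" "Inl y \<in> pverts D"
      unfolding adj by blast
    have "v \<in> I"
    proof (cases "v \<in> ?V")
      case True
      moreover have "Inl x \<in> W'"
        using xy(1) by (simp add: W_def)
      ultimately show ?thesis
        using final v(2) unfolding I_def by blast
    next
      case False
      thus ?thesis using v(1) by (simp add: I_def verts)
    qed
    moreover have "x \<in> C v" "y \<in> C v"
      using v mem by (auto simp: C_def verts)
    ultimately show "\<exists>i\<in>I. x \<in> C i \<and> y \<in> C i" by blast
  qed
qed

section \<open>The icosahedron\<close>

lemma icosahedron_arcD:
  assumes "(x, y) \<in> parcs icosahedron"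
  shows "x \<in> pverts icosahedron" "y \<in> pverts icosahedron" "x \<noteq> y" "(y, x) \<in> parcs icosahedron"
proof -
  interpret pair_graph icosahedron by (rule pair_graph_icosahedron)
  show "x \<in> pverts icosahedron" "y \<in> pverts icosahedron" "x \<noteq> y"
    using wellformed'[OF assms] pair_no_loops[OF assms] by auto
  show "(y, x) \<in> parcs icosahedron"
    using assms by (auto simp: icosahedron_def)
qed

text \<open>Adjacency lists let the simplifier decide neighbourhood properties by
  \<open>filter\<close>.\<close>

definition icosahedron_nbrs :: "nat \<Rightarrow> nat list" where
  "icosahedron_nbrs x =
     [[1, 2, 3, 4, 5], [0, 2, 5, 6, 7], [0, 1, 3, 7, 8], [0, 2, 4, 8, 9], [0, 3, 5, 9, 10],
      [0, 1, 4, 6, 10], [1, 5, 7, 10, 11], [1, 2, 6, 8, 11], [2, 3, 7, 9, 11], [3, 4, 8, 10, 11],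
      [4, 5, 6, 9, 11], [6, 7, 8, 9, 10]] ! x"

lemma icosahedron_arc_iff:
  "(x, y) \<in> parcs icosahedron \<longleftrightarrow> x \<in> pverts icosahedron \<and> y \<in> set (icosahedron_nbrs x)"
proof (cases "x \<in> pverts icosahedron")
  case True
  hence "(x, y) \<in> parcs icosahedron \<longleftrightarrow> y \<in> set (icosahedron_nbrs x)"
    unfolding icosahedron_verts_eq insert_iff empty_iff
    by (elim disjE FalseE)
      (simp_all add: icosahedron_def icosahedron_edges_eq icosahedron_nbrs_def disj_ac del: One_nat_def)
  with True show ?thesis by simp
next
  case False
  thus ?thesis using icosahedron_arcD(1) by blast
qed

lemma icosahedron_common_neighbours:
  assumes "(x, y) \<in> parcs icosahedron"
  obtains c d where "(c, d) \<notin> parcs icosahedron"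
    "{z. (x, z) \<in> parcs icosahedron \<and> (y, z) \<in> parcs icosahedron} = {c, d}"
proof -
  have verts: "x \<in> pverts icosahedron" "y \<in> pverts icosahedron"
    using icosahedron_arcD[OF assms] by simp_all
  \<comment> \<open>Evaluation over all 60 arcs; the pattern \<open>[c, d]\<close> demands exactly
    two common neighbours, the apexes of the two faces at the edge.\<close>
  have "\<forall>x\<in>pverts icosahedron. \<forall>y\<in>set (icosahedron_nbrs x).
      case filter (\<lambda>z. z \<in> set (icosahedron_nbrs y)) (icosahedron_nbrs x) of
        [c, d] \<Rightarrow> d \<notin> set (icosahedron_nbrs c) | _ \<Rightarrow> False"
    unfolding icosahedron_verts_eq by (simp add: icosahedron_nbrs_def del: One_nat_def)
  with assms have "case filter (\<lambda>z. z \<in> set (icosahedron_nbrs y)) (icosahedron_nbrs x) of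
        [c, d] \<Rightarrow> d \<notin> set (icosahedron_nbrs c) | _ \<Rightarrow> False"
    unfolding icosahedron_arc_iff by blast
  then obtain c d where cd: "filter (\<lambda>z. z \<in> set (icosahedron_nbrs y)) (icosahedron_nbrs x) = [c, d]"
    "d \<notin> set (icosahedron_nbrs c)"
    by (auto split: list.splits)
  have "{z. (x, z) \<in> parcs icosahedron \<and> (y, z) \<in> parcs icosahedron} =
      set (filter (\<lambda>z. z \<in> set (icosahedron_nbrs y)) (icosahedron_nbrs x))"
    using verts by (auto simp: icosahedron_arc_iff)
  also have "\<dots> = {c, d}"
    unfolding cd(1) by simp
  finally show ?thesis
    using cd(2) by (intro that[of c d]) (simp add: icosahedron_arc_iff)
qed

text \<open>Beyond two members \<open>x\<close>, \<open>y\<close>, a clique consists of common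
  neighbours of \<open>x\<close> and \<open>y\<close>; there are only two of these, and they are not
  adjacent.\<close>

lemma icosahedron_clique_card_le_3:
  assumes "C \<subseteq> pverts icosahedron"
    and clique: "\<And>x y. x \<in> C \<Longrightarrow> y \<in> C \<Longrightarrow> x \<noteq> y \<Longrightarrow> (x, y) \<in> parcs icosahedron"
  shows "finite C" "card C \<le> 3"
proof -
  show fin: "finite C"
    using assms(1) by (rule finite_subset) (simp add: icosahedron_verts_eq)
  show "card C \<le> 3"
  proof (cases "\<exists>x\<in>C. \<exists>y\<in>C. x \<noteq> y")
    case False
    hence "card C \<le> Suc 0"
      using fin by (auto simp: card_le_Suc0_iff_eq)
    thus ?thesis by simp
  next
    case True
    then obtain x y where xy: "x \<in> C" "y \<in> C" "x \<noteq> y" by blast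
    then obtain c d where cd: "(c, d) \<notin> parcs icosahedron"
      "{z. (x, z) \<in> parcs icosahedron \<and> (y, z) \<in> parcs icosahedron} = {c, d}"
      using icosahedron_common_neighbours[OF clique[OF xy]] by blast
    have "z \<in> {x, y, c, d}" if "z \<in> C" for z
    proof (cases "z = x \<or> z = y")
      case False
      hence "z \<in> {z. (x, z) \<in> parcs icosahedron \<and> (y, z) \<in> parcs icosahedron}"
        using clique that xy by simp
      thus ?thesis unfolding cd(2) by simp
    qed auto
    hence "C \<subseteq> {x, y, c, d}" by (rule subsetI)
    \<comment> \<open>Non-adjacency alone leaves \<open>c = d\<close> open, hence the first
      disjunct.\<close>
    moreover have "c = d \<or> c \<notin> C \<or> d \<notin> C"
      using clique cd(1) by blast
    ultimately have "C \<subseteq> {x, y, c} \<or> C \<subseteq> {x, y, d}" by blast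
    moreover have "card {x, y, c} \<le> 3" "card {x, y, d} \<le> 3"
      using card_length[of "[x, y, c]"] card_length[of "[x, y, d]"] by simp_all
    moreover have "card C \<le> card {x, y, e}" if "C \<subseteq> {x, y, e}" for e
      using that by (intro card_mono) simp_all
    ultimately show ?thesis
      using le_trans by blast
  qed
qed

text \<open>Besides \<open>z\<close>, \<open>x\<close> and \<open>y\<close> have one more common
  neighbour \<open>c\<close>; besides \<open>y\<close>, \<open>x\<close> and \<open>z\<close> have
  one more, \<open>d\<close>. So at most four of the five neighbours of \<open>x\<close> are
  excluded.\<close>

lemma icosahedron_private_neighbour:
  assumes "(x, y) \<in> parcs icosahedron" "(x, z) \<in> parcs icosahedron" "(y, z) \<in> parcs icosahedron"
  obtains b where "(x, b) \<in> parcs icosahedron" "b \<noteq> y" "b \<noteq> z"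
    "(y, b) \<notin> parcs icosahedron" "(z, b) \<notin> parcs icosahedron"
proof -
  let ?N = "\<lambda>x. {v. (x, v) \<in> parcs icosahedron}"
  obtain c where c: "{v. (x, v) \<in> parcs icosahedron \<and> (y, v) \<in> parcs icosahedron} \<subseteq> {z, c}"
  proof (rule icosahedron_common_neighbours[OF assms(1)])
    fix c d assume eq: "{v. (x, v) \<in> parcs icosahedron \<and> (y, v) \<in> parcs icosahedron} = {c, d}"
    have "z \<in> {c, d}" unfolding eq[symmetric] using assms by simp
    with eq that[of c] that[of d] show thesis by auto
  qed
  obtain d where d: "{v. (x, v) \<in> parcs icosahedron \<and> (z, v) \<in> parcs icosahedron} \<subseteq> {y, d}"
  proof (rule icosahedron_common_neighbours[OF assms(2)])
    fix c d assume eq: "{v. (x, v) \<in> parcs icosahedron \<and> (z, v) \<in> parcs icosahedron} = {c, d}"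
    have "y \<in> {c, d}" unfolding eq[symmetric] using assms icosahedron_arcD(4) by simp
    with eq that[of c] that[of d] show thesis by auto
  qed
  have "x \<in> pverts icosahedron"
    using assms(1) by (rule icosahedron_arcD)
  hence "card (?N x) = 5" by (rule icosahedron_5_regular)
  moreover have "card {y, z, c, d} \<le> 4"
    using card_length[of "[y, z, c, d]"] by simp
  ultimately have "\<not> ?N x \<subseteq> {y, z, c, d}"
    using card_mono[of "{y, z, c, d}" "?N x"] by auto
  then obtain b where "(x, b) \<in> parcs icosahedron" "b \<notin> {y, z, c, d}" by blast
  with c d show ?thesis by (intro that[of b]) auto
qed

section \<open>Covering the edges that meet three vertices\<close>

lemma icosahedron_clique_cover_ge_6:
  fixes I :: "'i set" and C :: "'i \<Rightarrow> nat set"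
  assumes W: "W \<subseteq> pverts icosahedron" "card W = 3" and I: "finite I"
    and sub: "\<And>i. i \<in> I \<Longrightarrow> C i \<subseteq> pverts icosahedron"
    and clique: "\<And>i x y. i \<in> I \<Longrightarrow> x \<in> C i \<Longrightarrow> y \<in> C i \<Longrightarrow> x \<noteq> y \<Longrightarrow> (x, y) \<in> parcs icosahedron"
    and cover: "\<And>x y. x \<in> W \<Longrightarrow> (x, y) \<in> parcs icosahedron \<Longrightarrow> \<exists>i\<in>I. x \<in> C i \<and> y \<in> C i"
  shows "card I \<ge> 6"
proof -
  let ?E = "parcs icosahedron"
  let ?N = "\<lambda>x. {v. (x, v) \<in> ?E}"
  have finC: "finite (C i)" and cardC: "card (C i) \<le> 3" if "i \<in> I" for i
    using icosahedron_clique_card_le_3[OF sub[OF that] clique[OF that]] by simp_all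
  have finW: "finite W"
    using W(2) card.infinite by fastforce
  have degree: "card (?N x) = 5" if "x \<in> W" for x
    using icosahedron_5_regular W(1) that by blast
  \<comment> \<open>A clique through \<open>x\<close> covers at most two of the five edges at
    \<open>x\<close>, so two cliques do not suffice.\<close>
  have three: "card {i\<in>I. x \<in> C i} \<ge> 3" if x: "x \<in> W" for x
  proof -
    let ?A = "{i\<in>I. x \<in> C i}"
    have "y \<in> (\<Union>i\<in>?A. C i - {x})" if "(x, y) \<in> ?E" for y
      using cover[OF x that] icosahedron_arcD(3)[OF that] by auto
    hence "?N x \<subseteq> (\<Union>i\<in>?A. C i - {x})" by blast
    hence "card (?N x) \<le> card (\<Union>i\<in>?A. C i - {x})"
      using I finC by (intro card_mono) auto
    also have "\<dots> \<le> (\<Sum>i\<in>?A. card (C i - {x}))"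
      using I by (intro card_UN_le) auto
    also have "\<dots> \<le> (\<Sum>i\<in>?A. 2)"
    proof (rule sum_mono)
      fix i assume "i \<in> ?A"
      thus "card (C i - {x}) \<le> 2"
        using cardC[of i] by (simp add: card_Diff_singleton)
    qed
    finally show ?thesis
      using degree[OF x] by simp
  qed
  show ?thesis
  proof (cases "\<forall>x\<in>W. \<forall>y\<in>W. x \<noteq> y \<longrightarrow> (x, y) \<in> ?E")
    case False
    then obtain x y where xy: "x \<in> W" "y \<in> W" "x \<noteq> y" "(x, y) \<notin> ?E" by blast
    have "card ({i\<in>I. x \<in> C i} \<union> {i\<in>I. y \<in> C i}) = card {i\<in>I. x \<in> C i} + card {i\<in>I. y \<in> C i}"
    proof (rule card_Un_disjoint)
      show "{i\<in>I. x \<in> C i} \<inter> {i\<in>I. y \<in> C i} = {}"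
        using clique[of _ x y] xy(3,4) by blast
    qed (use I in simp_all)
    moreover have "card ({i\<in>I. x \<in> C i} \<union> {i\<in>I. y \<in> C i}) \<le> card I"
      using I by (intro card_mono) auto
    ultimately show ?thesis
      using three[OF xy(1)] three[OF xy(2)] by linarith
  next
    case triangle: True
    show ?thesis
    proof (cases "\<exists>j\<in>I. W \<subseteq> C j")
      case True
      then obtain j where j: "j \<in> I" "W \<subseteq> C j" by blast
      hence "C j = W"
        using card_seteq[OF finC[OF j(1)] j(2)] cardC[OF j(1)] W(2) by simp
      \<comment> \<open>The edges leaving \<open>W\<close>: each corner has five neighbours, two of
        them in \<open>W\<close>, which gives 3 * 3 = 9.\<close>
      let ?P = "SIGMA x:W. ?N x - W"
      have "card (?N x - W) = 3" if x: "x \<in> W" for x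
      proof -
        have "?N x \<inter> W = W - {x}"
          using triangle x by (auto dest: icosahedron_arcD(3))
        hence "card (?N x \<inter> W) = 2"
          using W(2) x by simp
        moreover have "finite (?N x)"
          using degree[OF x] card.infinite by fastforce
        ultimately show ?thesis
          using card_Diff_subset_Int[of "?N x" W] finW degree[OF x] by simp
      qed
      hence "card ?P = 9"
        using finW W(2) by (simp add: card_SigmaI card_ge_0_finite)
      have "(x, y) \<in> (\<Union>i\<in>I - {j}. (C i \<inter> W) \<times> (C i - W))"
        if xy: "x \<in> W" "(x, y) \<in> ?E" "y \<notin> W" for x y
      proof -
        obtain i where "i \<in> I" "x \<in> C i" "y \<in> C i"
          using cover[OF xy(1,2)] by blast
        with xy \<open>C j = W\<close> show ?thesis by blast
      qed
      hence "?P \<subseteq> (\<Union>i\<in>I - {j}. (C i \<inter> W) \<times> (C i - W))" by blast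
      hence "card ?P \<le> card (\<Union>i\<in>I - {j}. (C i \<inter> W) \<times> (C i - W))"
        using I finC by (intro card_mono) auto
      also have "\<dots> \<le> (\<Sum>i\<in>I - {j}. card ((C i \<inter> W) \<times> (C i - W)))"
        using I by (intro card_UN_le) auto
      also have "\<dots> \<le> (\<Sum>i\<in>I - {j}. 2)"
      proof (intro sum_mono)
        fix i assume "i \<in> I - {j}"
        hence "card (C i \<inter> W) + card (C i - W) \<le> 3"
          using cardC[of i] finC[of i] card_Int_Diff[of "C i" W] by simp
        \<comment> \<open>With \<open>a\<close> vertices in \<open>W\<close> and \<open>b\<close>
          outside, a clique covers \<open>a * b\<close> of the leaving edges.\<close>
        moreover have "a * b \<le> 2" if "a + b \<le> 3" for a b :: nat
        proof -
          have "a = 0 \<or> a = 1 \<or> a = 2 \<or> a = 3" using that by linarith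
          thus ?thesis using that by auto
        qed
        ultimately show "card ((C i \<inter> W) \<times> (C i - W)) \<le> 2"
          by (simp add: card_cartesian_product)
      qed
      \<comment> \<open>As 9 is odd, this forces five cliques besides \<open>C j\<close>.\<close>
      finally have "9 \<le> 2 * (card I - 1)"
        using \<open>card ?P = 9\<close> I j(1) by simp
      thus ?thesis by linarith
    next
      case False
      obtain x y z where xyz: "W = {x, y, z}" "x \<noteq> y" "x \<noteq> z" "y \<noteq> z"
        using W(2) by (auto simp: card_3_iff)
      have E: "(x, y) \<in> ?E" "(x, z) \<in> ?E" "(y, z) \<in> ?E" "(y, x) \<in> ?E" "(z, x) \<in> ?E" "(z, y) \<in> ?E"
        using triangle xyz by auto
      obtain a where a: "(x, a) \<in> ?E" "a \<noteq> y" "a \<noteq> z" "(y, a) \<notin> ?E" "(z, a) \<notin> ?E"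
        using icosahedron_private_neighbour[OF E(1) E(2) E(3)] by blast
      obtain b where b: "(y, b) \<in> ?E" "b \<noteq> x" "b \<noteq> z" "(x, b) \<notin> ?E" "(z, b) \<notin> ?E"
        using icosahedron_private_neighbour[OF E(4) E(3) E(2)] by blast
      obtain c where c: "(z, c) \<in> ?E" "c \<noteq> x" "c \<noteq> y" "(x, c) \<notin> ?E" "(y, c) \<notin> ?E"
        using icosahedron_private_neighbour[OF E(5) E(6) E(1)] by blast
      have mem: "x \<in> W" "y \<in> W" "z \<in> W"
        using xyz(1) by simp_all
      obtain i1 where i1: "i1 \<in> I" "x \<in> C i1" "y \<in> C i1" using cover[OF mem(1) E(1)] by blast
      obtain i2 where i2: "i2 \<in> I" "y \<in> C i2" "z \<in> C i2" using cover[OF mem(2) E(3)] by blast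
      obtain i3 where i3: "i3 \<in> I" "z \<in> C i3" "x \<in> C i3" using cover[OF mem(3) E(5)] by blast
      obtain i4 where i4: "i4 \<in> I" "x \<in> C i4" "a \<in> C i4" using cover[OF mem(1) a(1)] by blast
      obtain i5 where i5: "i5 \<in> I" "y \<in> C i5" "b \<in> C i5" using cover[OF mem(2) b(1)] by blast
      obtain i6 where i6: "i6 \<in> I" "z \<in> C i6" "c \<in> C i6" using cover[OF mem(3) c(1)] by blast
      \<comment> \<open>A clique containing two edges of \<open>W\<close> would contain all of
        \<open>W\<close>.\<close>
      have "i1 \<noteq> i2" "i1 \<noteq> i3" "i2 \<noteq> i3"
        using False i1 i2 i3 xyz(1) by auto
      \<comment> \<open>By the choice of \<open>a\<close>, \<open>b\<close>, \<open>c\<close>, the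
        last three cliques each meet \<open>W\<close> in one corner, a different one each time,
        while the first three contain two corners.\<close>
      moreover have "y \<notin> C i4" "z \<notin> C i4"
        using clique[OF i4(1) _ i4(3)] a by auto
      moreover have "x \<notin> C i5" "z \<notin> C i5"
        using clique[OF i5(1) _ i5(3)] b by auto
      moreover have "x \<notin> C i6" "y \<notin> C i6"
        using clique[OF i6(1) _ i6(3)] c by auto
      ultimately have "distinct [i1, i2, i3, i4, i5, i6]"
        using i1 i2 i3 i4 i5 i6 by auto
      hence "card (set [i1, i2, i3, i4, i5, i6]) = length [i1, i2, i3, i4, i5, i6]"
        by (rule distinct_card)
      moreover have "card (set [i1, i2, i3, i4, i5, i6]) \<le> card I"
        using I i1 i2 i3 i4 i5 i6 by (intro card_mono) auto
      ultimately show ?thesis by simp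
    qed
  qed
qed

section \<open>A realisation with four extra vertices\<close>

lemma icosahedron_add_4_competition: "is_acyclic_competition_graph (add_isolated 4 icosahedron)"
proof -
  \<comment> \<open>\<open>T v\<close> is the in-neighbourhood of \<open>v\<close>. It is empty for
    3, 9 and 8, which come first in the order and so have fewer than three predecessors; each other
    vertex receives a triangle of earlier vertices.\<close>
  define T :: "nat + nat \<Rightarrow> nat set" where
    "T v = (case v of
       Inl x \<Rightarrow> [{2, 3, 8}, {4, 5, 10}, {3, 4, 9}, {}, {3, 8, 9}, {0, 2, 3}, {9, 10, 11}, {0, 1, 5}, {},
         {}, {0, 4, 5}, {1, 2, 7}] ! x
     | Inr x \<Rightarrow> [{1, 6, 7}, {1, 5, 6}, {6, 10, 11}, {7, 8, 11}] ! x)" for v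
  have T: "T (Inl 0) = {2, 3, 8}" "T (Inl 1) = {4, 5, 10}" "T (Inl 2) = {3, 4, 9}" "T (Inl 3) = {}"
    "T (Inl 4) = {3, 8, 9}" "T (Inl 5) = {0, 2, 3}" "T (Inl 6) = {9, 10, 11}"
    "T (Inl 7) = {0, 1, 5}" "T (Inl 8) = {}" "T (Inl 9) = {}" "T (Inl 10) = {0, 4, 5}"
    "T (Inl 11) = {1, 2, 7}" "T (Inr 0) = {1, 6, 7}" "T (Inr 1) = {1, 5, 6}"
    "T (Inr 2) = {6, 10, 11}" "T (Inr 3) = {7, 8, 11}"
    by (simp_all add: T_def del: One_nat_def)
  text \<open>The position in the acyclic order 3, 9, 8, 4, 2, 0, 5, 10, 1, 7, 11, 6, then the
    isolated vertices.\<close>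
  define rank :: "nat + nat \<Rightarrow> nat" where
    "rank v = (case v of Inl x \<Rightarrow> [5, 8, 4, 0, 3, 6, 11, 9, 2, 1, 7, 10] ! x | Inr _ \<Rightarrow> 12)" for v
  let ?V = "Inl ` pverts icosahedron \<union> Inr ` {..<4} :: (nat + nat) set"
  have V: "?V = {Inl 0, Inl 1, Inl 2, Inl 3, Inl 4, Inl 5, Inl 6, Inl 7, Inl 8, Inl 9, Inl 10, Inl 11,
      Inr 0, Inr 1, Inr 2, Inr 3}"
  proof -
    have "{..<4} = {0, 1, 2, 3 :: nat}" by auto
    thus ?thesis by (auto simp: icosahedron_verts_eq simp del: One_nat_def)
  qed
  have sub: "\<forall>v\<in>?V. T v \<subseteq> pverts icosahedron"
    unfolding V by (simp add: T icosahedron_verts_eq del: One_nat_def)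
  have clique: "\<forall>v\<in>?V. \<forall>x\<in>T v. \<forall>y\<in>T v. x \<noteq> y \<longrightarrow> (x, y) \<in> parcs icosahedron"
    unfolding V by (simp add: T icosahedron_def icosahedron_edges_eq del: One_nat_def)
  \<comment> \<open>One orientation of each edge suffices, as lying in a common \<open>T v\<close>
    is symmetric.\<close>
  have edges: "\<forall>(x, y)\<in>icosahedron_edges. \<exists>v\<in>?V. x \<in> T v \<and> y \<in> T v"
    unfolding V icosahedron_edges_eq by (simp add: T del: One_nat_def)
  have cover: "\<exists>v\<in>?V. x \<in> T v \<and> y \<in> T v" if "(x, y) \<in> parcs icosahedron" for x y
  proof -
    have "(x, y) \<in> icosahedron_edges \<or> (y, x) \<in> icosahedron_edges"
      using that by (auto simp: icosahedron_def)
    thus ?thesis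
      using bspec[OF edges, of "(x, y)"] bspec[OF edges, of "(y, x)"] by blast
  qed
  have rank: "\<forall>v\<in>?V. \<forall>x\<in>T v. rank (Inl x) < rank v"
    unfolding V by (simp add: T rank_def del: One_nat_def)
  show ?thesis
  proof (rule acyclic_competition_graphI[where C = T and rank = rank])
    show "pair_graph icosahedron" by (rule pair_graph_icosahedron)
    show "T v \<subseteq> pverts icosahedron" if "v \<in> ?V" for v
      using sub that by (rule bspec)
    show "(x, y) \<in> parcs icosahedron" if "v \<in> ?V" "x \<in> T v" "y \<in> T v" "x \<noteq> y" for v x y
      using bspec[OF clique that(1)] that(2-) by blast
    show "\<exists>v\<in>?V. x \<in> T v \<and> y \<in> T v" if "(x, y) \<in> parcs icosahedron" for x y
      using that by (rule cover)
    show "rank (Inl x) < rank v" if "v \<in> ?V" "x \<in> T v" for v x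
      using bspec[OF rank that(1)] that(2) by (rule bspec)
  qed
qed

theorem theorem2p5:
  shows "competition_number icosahedron = 4"
  unfolding competition_number_def
proof (rule Least_equality)
  show "is_acyclic_competition_graph (add_isolated 4 icosahedron)"
    by (rule icosahedron_add_4_competition)
next
  fix k assume "is_acyclic_competition_graph (add_isolated k icosahedron)"
  \<comment> \<open>Here \<open>m = 2\<close>: three final vertices and \<open>k + 2\<close>
    cliques, so the bound 6 gives \<open>4 \<le> k\<close>.\<close>
  moreover have "finite (pverts icosahedron)" "Suc 2 \<le> card (pverts icosahedron)"
    by (simp_all add: icosahedron_def)
  ultimately show "4 \<le> k"
  proof (rule acyclic_competition_graph_clique_cover)
    fix W and I :: "(nat + nat) set" and C
    assume "W \<subseteq> pverts icosahedron" "card W = Suc 2" "finite I" "card I = k + 2"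
      "\<And>i. i \<in> I \<Longrightarrow> C i \<subseteq> pverts icosahedron"
      "\<And>i x y. i \<in> I \<Longrightarrow> x \<in> C i \<Longrightarrow> y \<in> C i \<Longrightarrow> x \<noteq> y \<Longrightarrow> (x, y) \<in> parcs icosahedron"
      "\<And>x y. x \<in> W \<Longrightarrow> (x, y) \<in> parcs icosahedron \<Longrightarrow> \<exists>i\<in>I. x \<in> C i \<and> y \<in> C i"
    hence "card I \<ge> 6"
      by (intro icosahedron_clique_cover_ge_6[of W I C]) simp_all
    with \<open>card I = k + 2\<close> show "4 \<le> k" by simp
  qed
qed

end
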